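(* There is an absolute constant $C_2$ with the following property. Let $\omega_\theta:\Omega\to\mathbb{R}$ satisfy $$\|r^2\omega_\theta\|_{L^1(\Omega)}<\infty,\quad\|\omega_\theta\|_{L^1(\Omega)}<\infty,\quad\Big\|\frac{\omega_\theta}{r}\Big\|_{L^\infty(\Omega)}<\infty,$$ and let $$u_z(\bar r,\bar z)=\int_{-\infty}^\infty\int_0^\infty\mathscr{Z}(\bar r,\bar z,r,z)\,\omega_\theta(r,z)\,dr\,dz .$$ Then $$\|u_z\|_{L^\infty(\Omega)}\le C_2\,\|r^2\omega_\theta\|_{L^1(\Omega)}^{1/4}\,\|\omega_\theta\|_{L^1(\Omega)}^{1/4}\,\Big\|\frac{\omega_\theta}{r}\Big\|_{L^\infty(\Omega)}^{1/2}.$$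
   Context: $\Omega=\{(r,z): r\ge0,\ z\in\mathbb{R}\}$ is the $rz$-half-plane with the measure $dr\,dz$. Let $F(s)=\int_0^\pi\frac{\cos\varphi\,d\varphi}{[2(1-\cos\varphi)+s]^{1/2}}$ for $s>0$, let $G(\bar r,\bar z,r,z)=\frac{\sqrt{\bar r r}}{2\pi}F\!\left(\frac{(r-\bar r)^2+(z-\bar z)^2}{\bar r r}\right)$, and $\mathscr{Z}(\bar r,\bar z,r,z)=\frac1{\bar r}\frac{\partial G}{\partial\bar r}(\bar r,\bar z,r,z)$. Explicitly, with $\xi^2=\frac{(r-\bar r)^2+(z-\bar z)^2}{\bar r r}$, $\mathscr{Z}=\frac1\pi\frac{\bar r-r}{\bar r^{3/2}r^{1/2}}F'(\xi^2)+\frac1{4\pi}\big[F(\xi^2)-2\xi^2F'(\xi^2)\big]\frac{\sqrt r}{\bar r^{3/2}}$. (The formula for $u_z$ is the axi-symmetric Biot–Savart law for the axial component of the swirl-free axi-symmetric field with vorticity $\omega_\theta e_\theta$.) *)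

theory Defs
  imports "HOL-Probability.Essential_Supremum"
begin

definition F :: "real \<Rightarrow> real" where
  "F s = (LBINT \<phi>:{0..pi}. cos \<phi> / sqrt (2 * (1 - cos \<phi>) + s))"

definition G :: "real \<Rightarrow> real \<Rightarrow> real \<Rightarrow> real \<Rightarrow> real" where
  "G rb zb r z = sqrt (rb * r) / (2 * pi) * F (((r - rb)\<^sup>2 + (z - zb)\<^sup>2) / (rb * r))"

text \<open>Meaningful for \<open>rb > 0\<close>, \<open>r > 0\<close> and \<open>(r, z) \<noteq> (rb, zb)\<close>, where \<open>G\<close> is differentiable in
  \<open>rb\<close>; the axis \<open>r = 0\<close> and the single point \<open>(rb, zb)\<close> are null sets for the integrals below.\<close>

definition Z :: "real \<Rightarrow> real \<Rightarrow> real \<Rightarrow> real \<Rightarrow> real" where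
  "Z rb zb r z = 1 / rb * deriv (\<lambda>\<rho>. G \<rho> zb r z) rb"

text \<open>The half-plane with the measure \<open>dr dz\<close>; points are pairs \<open>(r, z)\<close>.\<close>

definition Omega :: "(real \<times> real) measure" where
  "Omega = restrict_space lebesgue {(r, z). r \<ge> 0}"

definition L1_norm :: "'a measure \<Rightarrow> ('a \<Rightarrow> real) \<Rightarrow> ennreal" where
  "L1_norm M f = (\<integral>\<^sup>+ x. ennreal \<bar>f x\<bar> \<partial>M)"

text \<open>By the convention of \<^const>\<open>esssup\<close>, this is \<open>\<infinity>\<close> when \<open>\<bar>f\<bar>\<close> is not measurable, so a finite
  bound on it includes measurability of \<open>\<bar>f\<bar>\<close>.\<close>

definition Linf_norm :: "'a measure \<Rightarrow> ('a \<Rightarrow> real) \<Rightarrow> ennreal" where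
  "Linf_norm M f = esssup M (\<lambda>x. ennreal \<bar>f x\<bar>)"

definition u_z :: "(real \<times> real \<Rightarrow> real) \<Rightarrow> real \<times> real \<Rightarrow> real" where
  "u_z \<omega> = (\<lambda>(rb, zb). LINT (r, z)|Omega. Z rb zb r z * \<omega> (r, z))"

end

theory Submission
  imports Defs
begin

text \<open>Write \<open>\<rho>, zb\<close> for the coordinates of the point where the velocity is evaluated (\<open>\<rho> = rb\<close>),
\<open>\<zeta> = z - zb\<close>, and \<open>D\<close> for the distance between \<open>(r, z)\<close> and \<open>(\<rho>, zb)\<close> in the half-plane.
In three dimensions, the squared distance between the point at angle \<open>0\<close> on the first ring and the
point at angle \<open>t\<close> on the second one is \<open>E\<^sup>2 = \<rho>\<^sup>2 + r\<^sup>2 - 2 \<rho> r cos t + \<zeta>\<^sup>2\<close>. In terms of \<open>E\<close>, the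
stream function kernel is \<open>\<rho> r / (2 \<pi>)\<close> times the integral of \<open>cos t / E\<close> over \<open>[0, \<pi>]\<close>.
Differentiating in \<open>\<rho>\<close> and subtracting the derivative of \<open>sin t / E\<close> gives back the
Biot-Savart kernel: \<open>r / (2 \<pi>)\<close> times the integral of \<open>(r - \<rho> cos t) / E\<^sup>3\<close>
(lemma \<open>Z_eq_axial_kernel\<close>).

The numerator is at most \<open>E\<close> in absolute value, and the remaining integral of \<open>1 / E\<^sup>2\<close> is the
Poisson integral, which is known exactly. This yields the single estimate
\<open>\<bar>Z\<bar> \<le> r / (D (D + \<rho>))\<close> (lemma \<open>axial_kernel_bound\<close>), which behaves like \<open>1 / D\<close> near the
singularity and decays like \<open>r / D\<^sup>2\<close>.

Let \<open>M\<close> bound \<open>\<bar>\<omega>\<bar> / r\<close> and let \<open>P\<close> be the integral of \<open>r \<bar>\<omega>\<bar>\<close>. Split the integral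
of \<open>\<bar>Z \<omega>\<bar>\<close> at \<open>D = \<delta>\<close>. Outside, it is at most \<open>P / (\<delta> (\<delta> + \<rho>))\<close>. Inside,
\<open>\<bar>\<omega>\<bar> \<le> M r\<close> and \<open>r \<le> D + \<rho>\<close> reduce the integrand to \<open>M (\<delta> + \<rho>) / D\<close>, whose integral is at most
\<open>16 M \<delta> (\<delta> + \<rho>)\<close>. The radius enters only through \<open>q = \<delta> (\<delta> + \<rho>)\<close>, which takes every positive value,
so the velocity is at most \<open>16 M q + P / q\<close> for every \<open>q > 0\<close>, hence at most \<open>8 sqrt (M P)\<close>, uniformly in
\<open>\<rho>\<close>. Finally \<open>P\<close> is at most the geometric mean of the integrals of
\<open>r\<^sup>2 \<bar>\<omega>\<bar>\<close> and \<open>\<bar>\<omega>\<bar>\<close>; this is the same optimisation over a parameter.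

The essential supremum also requires that the velocity is a measurable function of the evaluation
point. For this \<open>\<omega>\<close> is replaced by a Borel function equal to it almost everywhere,
and \<open>Z\<close> by the jointly measurable kernel above (lemma \<open>borel_measurable_u_z\<close>).\<close>

section \<open>The Biot-Savart kernel of a vortex ring\<close>

definition dist_sq :: "real \<Rightarrow> real \<Rightarrow> real \<Rightarrow> real \<Rightarrow> real" where
  "dist_sq \<rho> \<zeta> r t = \<rho>\<^sup>2 + r\<^sup>2 - 2 * \<rho> * r * cos t + \<zeta>\<^sup>2"

text \<open>The axial velocity that a vortex ring of radius \<open>r\<close> and unit circulation induces at radius \<open>\<rho>\<close> and
height difference \<open>\<zeta>\<close>, by the Biot-Savart law; symmetry reduces the circle to a half circle.
A Lebesgue integral is used because joint measurability in the parameters is then immediate.\<close>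
definition axial_kernel :: "real \<Rightarrow> real \<Rightarrow> real \<Rightarrow> real" where
  "axial_kernel \<rho> \<zeta> r =
     r / (2 * pi) * (LBINT t:{0..pi}. (r - \<rho> * cos t) / sqrt (dist_sq \<rho> \<zeta> r t) ^ 3)"

text \<open>The sum of squares of the Cartesian components of the difference of the two points; it shows positivity off
the plane \<open>\<zeta> = 0\<close> and that the numerator of the kernel is at most the distance.\<close>
lemma dist_sq_eq: "dist_sq \<rho> \<zeta> r t = (r - \<rho> * cos t)\<^sup>2 + (\<rho> * sin t)\<^sup>2 + \<zeta>\<^sup>2"
proof -
  have "\<rho>\<^sup>2 = \<rho>\<^sup>2 * ((sin t)\<^sup>2 + (cos t)\<^sup>2)" by simp
  then have "(\<rho> * sin t)\<^sup>2 + (\<rho> * cos t)\<^sup>2 = \<rho>\<^sup>2"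
    by (simp only: power_mult_distrib distrib_left)
  then show ?thesis
    unfolding dist_sq_def by (simp add: power2_diff algebra_simps)
qed

lemma dist_sq_pos: "\<zeta> \<noteq> 0 \<Longrightarrow> 0 < dist_sq \<rho> \<zeta> r t"
  by (simp add: dist_sq_eq add_nonneg_pos)

lemma continuous_on_dist_sq [continuous_intros]:
  fixes A :: "'a :: t2_space set"
  shows "continuous_on A f \<Longrightarrow> continuous_on A g \<Longrightarrow> continuous_on A h \<Longrightarrow> continuous_on A k \<Longrightarrow>
    continuous_on A (\<lambda>x. dist_sq (f x) (g x) (h x) (k x))"
  unfolding dist_sq_def by (intro continuous_intros)

lemma LBINT_eq_integral_of_continuous:
  fixes f :: "real \<Rightarrow> real"
  assumes "continuous_on {a..b} f"
  shows "(LBINT t:{a..b}. f t) = integral {a..b} f"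
  by (rule set_borel_integral_eq_integral)
     (use borel_integrable_compact[OF _ assms] in \<open>simp add: set_integrable_def\<close>)

text \<open>The Poisson integral. The usual antiderivative in terms of \<open>tan (t / 2)\<close> blows up at \<open>pi\<close>; the one used here
comes from writing the integrand as a multiple of the Poisson kernel
\<open>(1 - k\<^sup>2) / (1 - 2 k cos t + k\<^sup>2)\<close> with \<open>k = b / (a + S)\<close>, and it is smooth on the whole line.\<close>
lemma has_integral_inverse_sub_mult_cos:
  fixes a b :: real
  assumes "\<bar>b\<bar> < a"
  shows "((\<lambda>t. 1 / (a - b * cos t)) has_integral pi / sqrt (a\<^sup>2 - b\<^sup>2)) {0..pi}"
proof -
  define S where "S = sqrt (a\<^sup>2 - b\<^sup>2)"
  have ab: "b\<^sup>2 < a\<^sup>2" using power2_strict_mono[of b a] assms by simp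
  then have S: "S > 0" and S2: "S\<^sup>2 = a\<^sup>2 - b\<^sup>2" by (simp_all add: S_def)
  have pos: "a - b * cos t > 0" for t
  proof -
    have "b * cos t \<le> \<bar>b\<bar> * 1"
      by (rule order_trans[OF abs_ge_self]) (unfold abs_mult, rule mult_left_mono, auto)
    then show ?thesis using assms by simp
  qed
  define H where "H t = (t + 2 * arctan (b * sin t / (a + S - b * cos t))) / S" for t
  have "(H has_real_derivative 1 / (a - b * cos t)) (at t)" for t
  proof -
    define c s where "c = cos t" and "s = sin t"
    have cs: "s\<^sup>2 = 1 - c\<^sup>2" by (simp add: c_def s_def sin_squared_eq)
    have p: "a - b * c > 0" using pos[of t] by (simp add: c_def)
    then have q: "a + S - b * c > 0" using S by simp
    have "a > 0" using assms by linarith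
    then have aS: "a + S > 0" using S by simp
    \<comment> \<open>The denominator \<open>1 + arg\<^sup>2\<close> factors because \<open>b\<^sup>2 = (a + S) * (a - S)\<close>.\<close>
    have fac: "(a + S - b * c)\<^sup>2 + (b * s)\<^sup>2 = 2 * (a + S) * (a - b * c)"
      unfolding power_mult_distrib cs using S2 by (simp add: power2_eq_square algebra_simps)
    have num: "b * c * (a + S - b * c) - b * s * (b * s) = (a + S) * (b * c - a + S)"
    proof -
      have "b * s * (b * s) = b\<^sup>2 * (1 - c\<^sup>2)" unfolding cs[symmetric] by (simp add: power2_eq_square)
      then show ?thesis using S2 by (simp add: power2_eq_square algebra_simps)
    qed
    have "((\<lambda>t. b * sin t / (a + S - b * cos t)) has_real_derivative
            (b * c * (a + S - b * c) - b * s * (b * s)) / (a + S - b * c)\<^sup>2) (at t)"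
      using q by (auto intro!: derivative_eq_intros simp: c_def s_def power2_eq_square)
    from DERIV_chain2[OF DERIV_arctan this]
    have "((\<lambda>t. arctan (b * sin t / (a + S - b * cos t))) has_real_derivative
            inverse (1 + (b * s / (a + S - b * c))\<^sup>2) *
              ((b * c * (a + S - b * c) - b * s * (b * s)) / (a + S - b * c)\<^sup>2)) (at t)"
      by (simp add: c_def s_def)
    moreover have "inverse (1 + (b * s / (a + S - b * c))\<^sup>2) * (N / (a + S - b * c)\<^sup>2)
        = N / ((a + S - b * c)\<^sup>2 + (b * s)\<^sup>2)" for N
    proof -
      have "1 + (b * s / (a + S - b * c))\<^sup>2 = ((a + S - b * c)\<^sup>2 + (b * s)\<^sup>2) / (a + S - b * c)\<^sup>2"
        using q by (simp add: power_divide add_divide_distrib)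
      then show ?thesis using q by simp
    qed
    moreover have "(a + S) * (b * c - a + S) / (2 * (a + S) * (a - b * c)) = (b * c - a + S) / (2 * (a - b * c))"
      using aS by (simp only: mult.assoc mult.left_commute[of 2 "a + S"] mult_divide_mult_cancel_left less_irrefl simp_thms)
    ultimately have "((\<lambda>t. arctan (b * sin t / (a + S - b * cos t))) has_real_derivative
            (b * c - a + S) / (2 * (a - b * c))) (at t)"
      by (simp only: num fac)
    then have "(H has_real_derivative (1 + 2 * ((b * c - a + S) / (2 * (a - b * c)))) / S) (at t)"
      unfolding H_def by (intro DERIV_cdivide DERIV_add DERIV_ident DERIV_cmult)
    moreover have "(1 + 2 * ((b * c - a + S) / (2 * (a - b * c)))) / S = 1 / (a - b * c)"
      using S p by (simp add: field_simps)
    ultimately show ?thesis by (simp add: c_def)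
  qed
  then have "((\<lambda>t. 1 / (a - b * cos t)) has_integral H pi - H 0) {0..pi}"
    by (intro fundamental_theorem_of_calculus)
       (auto simp flip: has_real_derivative_iff_has_vector_derivative intro: has_field_derivative_at_within)
  then show ?thesis by (simp add: H_def S_def)
qed

text \<open>Multiplying the radicand in \<open>F\<close> by \<open>\<rho> r\<close> turns it into the squared distance, so that the dependence
on \<open>\<rho>\<close> becomes smooth and elementary.\<close>
lemma G_eq_integral:
  assumes "\<rho> > 0" "r > 0" "z \<noteq> zb"
  shows "G \<rho> zb r z = r / (2 * pi) * integral {0..pi} (\<lambda>t. \<rho> * cos t / sqrt (dist_sq \<rho> (z - zb) r t))"
proof -
  have nz: "dist_sq \<rho> (z - zb) r t \<noteq> 0" for t using dist_sq_pos[of "z - zb" \<rho> r t] assms by simp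
  have pr: "\<rho> * r > 0" using assms by simp
  have cancel: "cos t / sqrt (2 * (1 - cos t) + ((r - \<rho>)\<^sup>2 + (z - zb)\<^sup>2) / (\<rho> * r))
      = sqrt (\<rho> * r) * (cos t / sqrt (dist_sq \<rho> (z - zb) r t))" for t
  proof -
    have "2 * (1 - cos t) + ((r - \<rho>)\<^sup>2 + (z - zb)\<^sup>2) / (\<rho> * r) = dist_sq \<rho> (z - zb) r t / (\<rho> * r)"
      using assms unfolding dist_sq_def by (simp add: field_simps power2_eq_square)
    then show ?thesis by (simp add: real_sqrt_divide)
  qed
  define I where "I = integral {0..pi} (\<lambda>t. cos t / sqrt (dist_sq \<rho> (z - zb) r t))"
  have "F (((r - \<rho>)\<^sup>2 + (z - zb)\<^sup>2) / (\<rho> * r)) =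
      integral {0..pi} (\<lambda>t. sqrt (\<rho> * r) * (cos t / sqrt (dist_sq \<rho> (z - zb) r t)))"
    unfolding F_def cancel
    by (rule LBINT_eq_integral_of_continuous) (intro continuous_intros, simp add: nz)
  also have "\<dots> = sqrt (\<rho> * r) * I"
    unfolding I_def by (rule integral_mult_right)
  finally have "G \<rho> zb r z = sqrt (\<rho> * r) * sqrt (\<rho> * r) / (2 * pi) * I"
    unfolding G_def by (simp only: times_divide_eq_left mult.assoc)
  also have "\<dots> = r / (2 * pi) * (\<rho> * I)" using pr by simp
  also have "\<rho> * I = integral {0..pi} (\<lambda>t. \<rho> * (cos t / sqrt (dist_sq \<rho> (z - zb) r t)))"
    unfolding I_def by (rule integral_mult_right[symmetric])
  finally show ?thesis by (simp only: times_divide_eq_right)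
qed

text \<open>The two derivatives that enter the kernel: in the radius, to differentiate \<open>G\<close>, and in the angle, to
integrate by parts.\<close>
lemma DERIV_inverse_distance:
  assumes "\<zeta> \<noteq> 0"
  shows "((\<lambda>\<rho>. \<rho> * cos t / sqrt (dist_sq \<rho> \<zeta> r t)) has_real_derivative
    cos t / sqrt (dist_sq \<rho> \<zeta> r t) - \<rho> * cos t * (\<rho> - r * cos t) / sqrt (dist_sq \<rho> \<zeta> r t) ^ 3) (at \<rho>)"
    (is ?A)
  and "((\<lambda>t. sin t / sqrt (dist_sq \<rho> \<zeta> r t)) has_real_derivative
    cos t / sqrt (dist_sq \<rho> \<zeta> r t) - \<rho> * r * (sin t)\<^sup>2 / sqrt (dist_sq \<rho> \<zeta> r t) ^ 3) (at t)"
    (is ?B)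
proof -
  define e where "e = sqrt (dist_sq \<rho> \<zeta> r t)"
  have pos: "dist_sq \<rho> \<zeta> r t > 0" using dist_sq_pos[OF assms] .
  then have e: "e \<noteq> 0" by (simp add: e_def)
  have half: "inverse e / 2 * (2 * x) = x / e" for x using e by (simp add: field_simps)
  have quot: "(p * e - q * (x / e)) / (e * e) = p / e - q * x / e ^ 3" for p q x
    using e by (simp add: diff_divide_distrib power3_eq_cube)
  have "((\<lambda>\<rho>. dist_sq \<rho> \<zeta> r t) has_real_derivative 2 * (\<rho> - r * cos t)) (at \<rho>)"
    unfolding dist_sq_def by (auto intro!: derivative_eq_intros simp: algebra_simps)
  from DERIV_chain2[OF DERIV_real_sqrt[OF pos] this]
  have *: "((\<lambda>\<rho>. sqrt (dist_sq \<rho> \<zeta> r t)) has_real_derivative (\<rho> - r * cos t) / e) (at \<rho>)"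
    unfolding e_def[symmetric] half .
  have "((\<lambda>\<rho>. \<rho> * cos t) has_real_derivative cos t) (at \<rho>)"
    by (auto intro!: derivative_eq_intros)
  from DERIV_divide[OF this *] have "((\<lambda>\<rho>. \<rho> * cos t / sqrt (dist_sq \<rho> \<zeta> r t)) has_real_derivative
      (cos t * e - \<rho> * cos t * ((\<rho> - r * cos t) / e)) / (e * e)) (at \<rho>)"
    using e unfolding e_def by simp
  then show ?A unfolding quot unfolding e_def .
  have "((\<lambda>t. dist_sq \<rho> \<zeta> r t) has_real_derivative 2 * (\<rho> * r * sin t)) (at t)"
    unfolding dist_sq_def by (auto intro!: derivative_eq_intros simp: algebra_simps)
  from DERIV_chain2[OF DERIV_real_sqrt[OF pos] this]
  have "((\<lambda>t. sqrt (dist_sq \<rho> \<zeta> r t)) has_real_derivative (\<rho> * r * sin t) / e) (at t)"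
    unfolding e_def[symmetric] half .
  from DERIV_divide[OF DERIV_sin this]
  have "((\<lambda>t. sin t / sqrt (dist_sq \<rho> \<zeta> r t)) has_real_derivative
      (cos t * e - sin t * ((\<rho> * r * sin t) / e)) / (e * e)) (at t)"
    using e unfolding e_def by simp
  then have "((\<lambda>t. sin t / sqrt (dist_sq \<rho> \<zeta> r t)) has_real_derivative
      cos t / e - sin t * (\<rho> * r * sin t) / e ^ 3) (at t)"
    unfolding quot .
  moreover have "sin t * (\<rho> * r * sin t) = \<rho> * r * (sin t)\<^sup>2"
    by (simp add: power2_eq_square)
  ultimately show ?B unfolding e_def by simp
qed

text \<open>Differentiation under the integral sign. The restriction \<open>z \<noteq> zb\<close> keeps the integrand smooth for all
\<open>\<rho>\<close> at once and excludes only a null set of points \<open>(r, z)\<close>.\<close>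
lemma Z_eq_axial_kernel:
  assumes \<rho>: "\<rho> > 0" and r: "r > 0" and z: "z \<noteq> zb"
  shows "Z \<rho> zb r z = axial_kernel \<rho> (z - zb) r"
proof -
  define \<zeta> where "\<zeta> = z - zb"
  have \<zeta>: "\<zeta> \<noteq> 0" using z by (simp add: \<zeta>_def)
  have nz: "dist_sq \<rho> \<zeta> r t \<noteq> 0" for \<rho> t using dist_sq_pos[OF \<zeta>, of \<rho> r t] by simp
  define e where "e \<rho> t = sqrt (dist_sq \<rho> \<zeta> r t)" for \<rho> t
  have epos: "e \<rho> t > 0" for \<rho> t using dist_sq_pos[OF \<zeta>] by (simp add: e_def)
  define k where "k t = (r - \<rho> * cos t) / e \<rho> t ^ 3" for t
  define f' where "f' \<rho> t = cos t / e \<rho> t - \<rho> * cos t * (\<rho> - r * cos t) / e \<rho> t ^ 3" for \<rho> t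
  have "((\<lambda>\<rho>. integral (cbox 0 pi) (\<lambda>t. \<rho> * cos t / e \<rho> t)) has_real_derivative
      integral (cbox 0 pi) (f' \<rho>)) (at \<rho> within {0<..})"
  proof (rule leibniz_rule_field_derivative)
    show "((\<lambda>\<rho>. \<rho> * cos t / e \<rho> t) has_real_derivative f' x t) (at x within {0<..})" for x t
      unfolding f'_def e_def
      by (rule has_field_derivative_at_within) (rule DERIV_inverse_distance(1)[OF \<zeta>])
    show "(\<lambda>t. x * cos t / e x t) integrable_on cbox 0 pi" for x
      unfolding e_def by (intro integrable_continuous continuous_intros) (simp add: nz)
    show "continuous_on ({0<..} \<times> cbox 0 pi) (\<lambda>(x, t). f' x t)"
      unfolding f'_def e_def case_prod_unfold by (intro continuous_intros) (auto simp: nz)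
  qed (use \<rho> in auto)
  then have der: "((\<lambda>\<rho>. integral {0..pi} (\<lambda>t. \<rho> * cos t / e \<rho> t)) has_real_derivative
      integral {0..pi} (f' \<rho>)) (at \<rho>)"
    using at_within_open[of \<rho> "{0<..}"] \<rho> by simp
  have "((\<lambda>\<rho>. G \<rho> zb r z) has_real_derivative r / (2 * pi) * integral {0..pi} (f' \<rho>)) (at \<rho>)"
    by (rule has_field_derivative_transform_within_open[OF DERIV_cmult[OF der], where S = "{0<..}"])
       (use \<rho> r z in \<open>auto simp: G_eq_integral e_def \<zeta>_def\<close>)
  then have "deriv (\<lambda>\<rho>. G \<rho> zb r z) \<rho> = r / (2 * pi) * integral {0..pi} (f' \<rho>)"
    by (rule DERIV_imp_deriv)
  \<comment> \<open>Subtracting the derivative of \<open>sin t / e\<close>, which vanishes at both end points, cancels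
    the term \<open>cos t / e\<close> and leaves a multiple of \<open>1 / e ^ 3\<close>.\<close>
  moreover have "integral {0..pi} (f' \<rho>) = \<rho> * integral {0..pi} k"
  proof -
    define h' where "h' t = cos t / e \<rho> t - \<rho> * r * (sin t)\<^sup>2 / e \<rho> t ^ 3" for t
    have "(h' has_integral sin pi / e \<rho> pi - sin 0 / e \<rho> 0) {0..pi}"
      by (rule fundamental_theorem_of_calculus)
         (auto simp: h'_def e_def simp flip: has_real_derivative_iff_has_vector_derivative
           intro!: has_field_derivative_at_within DERIV_inverse_distance(2)[OF \<zeta>])
    then have h: "(h' has_integral 0) {0..pi}" by simp
    have "k integrable_on {0..pi}"
      unfolding k_def e_def by (intro integrable_continuous_interval continuous_intros) (simp add: nz)
    then have "(k has_integral integral {0..pi} k) {0..pi}" by (rule integrable_integral)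
    from has_integral_add[OF h has_integral_mult_right[OF this, of \<rho>]]
    have "((\<lambda>t. h' t + \<rho> * k t) has_integral \<rho> * integral {0..pi} k) {0..pi}" by simp
    moreover have "h' t + \<rho> * k t = f' \<rho> t" for t
    proof -
      have "f' \<rho> t - h' t = (\<rho> * r * (sin t)\<^sup>2 - \<rho> * cos t * (\<rho> - r * cos t)) / e \<rho> t ^ 3"
        unfolding f'_def h'_def by (simp add: diff_divide_distrib)
      also have "\<rho> * r * (sin t)\<^sup>2 - \<rho> * cos t * (\<rho> - r * cos t) = \<rho> * (r - \<rho> * cos t)"
        unfolding sin_squared_eq by (simp add: power2_eq_square algebra_simps)
      finally show ?thesis by (simp add: k_def)
    qed
    ultimately show ?thesis by (simp add: integral_unique)
  qed
  moreover have "axial_kernel \<rho> \<zeta> r = r / (2 * pi) * integral {0..pi} k"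
    unfolding axial_kernel_def k_def e_def
    by (subst LBINT_eq_integral_of_continuous) (auto intro!: continuous_intros simp: nz)
  ultimately show ?thesis using \<rho> by (simp add: Z_def \<zeta>_def)
qed

text \<open>The integrand is bounded by the inverse squared distance, whose integral is \<open>pi / (D * D')\<close>, where
\<open>D\<close> and \<open>D'\<close> are the smallest and the largest distance between the evaluation point and the ring.
Both \<open>D\<close> and \<open>\<rho>\<close> are at most \<open>D'\<close>.\<close>
lemma axial_kernel_bound:
  assumes \<rho>: "\<rho> > 0" and r: "r > 0" and \<zeta>: "\<zeta> \<noteq> 0"
  defines "D \<equiv> sqrt ((r - \<rho>)\<^sup>2 + \<zeta>\<^sup>2)"
  shows "\<bar>axial_kernel \<rho> \<zeta> r\<bar> \<le> r / (D * (D + \<rho>))"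
proof -
  have pos: "dist_sq \<rho> \<zeta> r t > 0" for t using dist_sq_pos[OF \<zeta>] .
  then have nz: "dist_sq \<rho> \<zeta> r t \<noteq> 0" for t by (metis less_irrefl)
  define k where "k t = (r - \<rho> * cos t) / sqrt (dist_sq \<rho> \<zeta> r t) ^ 3" for t
  define a b where "a = \<rho>\<^sup>2 + r\<^sup>2 + \<zeta>\<^sup>2" and "b = 2 * \<rho> * r"
  define D' where "D' = sqrt ((r + \<rho>)\<^sup>2 + \<zeta>\<^sup>2)"
  have D: "D > 0" using \<zeta> by (simp add: D_def add_nonneg_pos)
  have D': "D' > 0" using \<zeta> by (simp add: D'_def add_nonneg_pos)
  have b: "b > 0" using \<rho> r by (simp add: b_def)
  have amb: "a - b = (r - \<rho>)\<^sup>2 + \<zeta>\<^sup>2" and apb: "a + b = (r + \<rho>)\<^sup>2 + \<zeta>\<^sup>2"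
    by (simp_all add: a_def b_def power2_eq_square algebra_simps)
  have "a - b > 0" unfolding amb using \<zeta> by (simp add: add_nonneg_pos)
  then have ab: "\<bar>b\<bar> < a" using b by simp
  have "a\<^sup>2 - b\<^sup>2 = (a - b) * (a + b)" by (simp add: power2_eq_square algebra_simps)
  then have S: "sqrt (a\<^sup>2 - b\<^sup>2) = D * D'"
    unfolding amb apb D_def D'_def by (simp add: real_sqrt_mult)
  have d: "dist_sq \<rho> \<zeta> r t = a - b * cos t" for t by (simp add: dist_sq_def a_def b_def)
  have P: "((\<lambda>t. 1 / dist_sq \<rho> \<zeta> r t) has_integral pi / (D * D')) {0..pi}"
    using has_integral_inverse_sub_mult_cos[OF ab] unfolding S d .
  have kb: "\<bar>k t\<bar> \<le> 1 / dist_sq \<rho> \<zeta> r t" for t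
  proof -
    define e where "e = sqrt (dist_sq \<rho> \<zeta> r t)"
    have e: "e > 0" "e\<^sup>2 = dist_sq \<rho> \<zeta> r t" using pos[of t] by (simp_all add: e_def)
    have "\<bar>r - \<rho> * cos t\<bar> \<le> e"
      unfolding e_def by (rule real_le_rsqrt) (simp add: dist_sq_eq)
    then have "\<bar>k t\<bar> \<le> e / e ^ 3"
      unfolding k_def e_def[symmetric] using e by (simp add: divide_right_mono abs_divide)
    also have "e / e ^ 3 = 1 / e\<^sup>2" using e by (simp add: power2_eq_square power3_eq_cube)
    finally show ?thesis using e by simp
  qed
  have ki: "k integrable_on {0..pi}"
    unfolding k_def by (intro integrable_continuous_interval continuous_intros) (simp add: nz)
  have "norm (integral {0..pi} k) \<le> integral {0..pi} (\<lambda>t. 1 / dist_sq \<rho> \<zeta> r t)"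
    by (rule integral_norm_bound_integral[OF ki has_integral_integrable[OF P]]) (use kb in simp)
  then have I: "\<bar>integral {0..pi} k\<bar> \<le> pi / (D * D')"
    using integral_unique[OF P] by simp
  have "axial_kernel \<rho> \<zeta> r = r / (2 * pi) * integral {0..pi} k"
    unfolding axial_kernel_def k_def
    by (subst LBINT_eq_integral_of_continuous) (auto intro!: continuous_intros simp: nz)
  then have "\<bar>axial_kernel \<rho> \<zeta> r\<bar> = r / (2 * pi) * \<bar>integral {0..pi} k\<bar>"
    using r by (simp add: abs_mult)
  also have "\<dots> \<le> r / (2 * pi) * (pi / (D * D'))"
    using r by (intro mult_left_mono I) auto
  also have "\<dots> = r / (D * (2 * D'))" by simp
  also have "\<dots> \<le> r / (D * (D + \<rho>))"
  proof -
    have "D \<le> D'" unfolding D_def D'_def using \<rho> r by (simp add: power2_eq_square algebra_simps)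
    moreover have "\<rho> \<le> D'" unfolding D'_def
    proof (rule real_le_rsqrt)
      have "\<rho>\<^sup>2 \<le> (r + \<rho>)\<^sup>2" using \<rho> r by (intro power_mono) auto
      then show "\<rho>\<^sup>2 \<le> (r + \<rho>)\<^sup>2 + \<zeta>\<^sup>2" by (simp add: add_increasing2)
    qed
    ultimately show ?thesis
      using D D' \<rho> r by (intro divide_left_mono mult_left_mono mult_pos_pos) auto
  qed
  finally show ?thesis .
qed

section \<open>Integrals over the half-plane\<close>

text \<open>The minimum of the right-hand side is attained at \<open>t = sqrt (b / a)\<close> if both coefficients are positive; otherwise
the infimum is \<open>0\<close>, approached as \<open>t\<close> tends to infinity or to zero.\<close>
lemma le_geometric_mean:
  fixes x a b :: real
  assumes le: "\<And>t. t > 0 \<Longrightarrow> x \<le> a * t + b / t" and a: "a \<ge> 0" and b: "b \<ge> 0"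
  shows "x \<le> 2 * sqrt (a * b)"
proof (cases "a > 0 \<and> b > 0")
  case True
  define p q where "p = sqrt a" and "q = sqrt b"
  have pq: "p > 0" "q > 0" "a = p * p" "b = q * q" using True by (simp_all add: p_def q_def)
  then have "x \<le> p * p * (q / p) + q * q / (q / p)" using le[of "q / p"] by simp
  also have "\<dots> = 2 * (p * q)" using pq by simp
  also have "p * q = sqrt (a * b)" by (simp add: p_def q_def real_sqrt_mult)
  finally show ?thesis .
next
  case False
  then have ab: "a = 0 \<or> b = 0" using a b by auto
  have "x \<le> 0"
  proof (rule ccontr)
    assume "\<not> x \<le> 0"
    then have x: "x > 0" by simp
    have "x \<le> b / ((b + 1) / x)" if "a = 0" using le[of "(b + 1) / x"] that x b by simp
    moreover have "x \<le> a * (x / (a + 1))" if "b = 0" using le[of "x / (a + 1)"] that x a by simp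
    ultimately show False using ab x a b by (auto simp: field_simps)
  qed
  then show ?thesis using ab by auto
qed

lemma nn_integral_inverse_sqrt_abs:
  fixes \<delta> :: real
  assumes "\<delta> \<ge> 0"
  shows "(\<integral>\<^sup>+ x. ennreal (indicator {-\<delta>..\<delta>} x / sqrt \<bar>x\<bar>) \<partial>lborel) = ennreal (4 * sqrt \<delta>)"
proof -
  have eq: "x powr (-1/2) = 1 / sqrt \<bar>x\<bar>" if "x \<in> {0..\<delta>}" for x
    using that powr_minus_divide[of x "1/2"] by (simp add: powr_half_sqrt)
  have "((\<lambda>x. x powr (-1/2)) has_integral (\<delta> powr (-1/2 + 1) / (-1/2 + 1))) {0..\<delta>}"
    by (rule has_integral_powr_from_0) (use assms in auto)
  also have "\<delta> powr (-1/2 + 1) / (-1/2 + 1) = 2 * sqrt \<delta>"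
    using assms by (simp add: powr_half_sqrt)
  finally have right: "((\<lambda>x. 1 / sqrt \<bar>x\<bar>) has_integral 2 * sqrt \<delta>) {0..\<delta>}"
    using has_integral_eq[of "{0..\<delta>}" "\<lambda>x. x powr (-1/2)" "\<lambda>x. 1 / sqrt \<bar>x\<bar>"] eq by blast
  have left: "((\<lambda>x. 1 / sqrt \<bar>x\<bar>) has_integral 2 * sqrt \<delta>) {-\<delta>..0}"
    using has_integral_reflect_real[of "\<lambda>x. 1 / sqrt \<bar>x\<bar>" "2 * sqrt \<delta>" \<delta> 0] right
    by (simp only: abs_minus_cancel minus_zero)
  have "((\<lambda>x. 1 / sqrt \<bar>x\<bar>) has_integral 2 * sqrt \<delta> + 2 * sqrt \<delta>) {-\<delta>..\<delta>}"
    by (rule has_integral_combine[OF _ _ left right]) (use assms in auto)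
  then have "((\<lambda>x. if x \<in> {-\<delta>..\<delta>} then 1 / sqrt \<bar>x\<bar> else 0) has_integral 4 * sqrt \<delta>) UNIV"
    unfolding has_integral_restrict_UNIV by simp
  also have "(\<lambda>x. if x \<in> {-\<delta>..\<delta>} then 1 / sqrt \<bar>x\<bar> else 0) = (\<lambda>x. indicator {-\<delta>..\<delta>} x / sqrt \<bar>x\<bar>)"
    by (rule ext) (simp add: indicator_def)
  finally show ?thesis
    by (intro nn_integral_has_integral_lborel) (auto intro: divide_nonneg_nonneg)
qed

lemma AE_fst_neq_snd_neq:
  fixes a b :: real
  shows "AE x in lborel. fst x \<noteq> a \<and> snd x \<noteq> b"
proof -
  have "negligible {x::real \<times> real. x \<bullet> (1, 0) = a}" "negligible {x::real \<times> real. x \<bullet> (0, 1) = b}"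
    by (intro negligible_standard_hyperplane; simp add: Basis_prod_def)+
  then have "{x::real \<times> real. fst x = a} \<in> null_sets lebesgue" "{x::real \<times> real. snd x = b} \<in> null_sets lebesgue"
    by (simp_all add: negligible_iff_null_sets inner_prod_def)
  then have "AE x in lebesgue. fst x \<noteq> a \<and> snd x \<noteq> b"
    by (auto dest: AE_not_in)
  then show ?thesis by (simp add: AE_completion_iff)
qed

text \<open>What remains of the kernel bound near the evaluation point \<open>p\<close> once the bounds \<open>\<bar>\<omega>\<bar> \<le> M * r\<close> and
\<open>r \<le> D + rb\<close> have absorbed the factors \<open>r\<close> and \<open>D + rb\<close>.\<close>
definition disc_potential :: "real \<times> real \<Rightarrow> real \<Rightarrow> real \<times> real \<Rightarrow> real" where
  "disc_potential p \<delta> x = (if dist x p < \<delta> then 1 / dist x p else 0)"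

lemma borel_measurable_disc_potential [measurable]: "disc_potential p \<delta> \<in> borel_measurable borel"
  unfolding disc_potential_def by measurable

text \<open>Polar coordinates would give \<open>2 pi \<delta>\<close>. Since \<open>\<bar>u\<bar> * \<bar>v\<bar> \<le> u\<^sup>2 + v\<^sup>2\<close>, the integrand is dominated by the product
\<open>1 / (sqrt \<bar>u\<bar> * sqrt \<bar>v\<bar>)\<close> on a square, which integrates to \<open>(4 * sqrt \<delta>)\<^sup>2\<close>.\<close>
lemma nn_integral_disc_potential_le:
  assumes "\<delta> > 0"
  shows "(\<integral>\<^sup>+ x. ennreal (disc_potential p \<delta> x) \<partial>lborel) \<le> ennreal (16 * \<delta>)"
proof -
  define g :: "real \<Rightarrow> real" where "g x = indicator {-\<delta>..\<delta>} x / sqrt \<bar>x\<bar>" for x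
  have [measurable]: "g \<in> borel_measurable borel" unfolding g_def by measurable
  have g0: "g x \<ge> 0" for x by (simp add: g_def)
  have shift: "(\<integral>\<^sup>+ x. ennreal (g (x - c)) \<partial>lborel) = ennreal (4 * sqrt \<delta>)" for c
    using nn_integral_real_affine[of "\<lambda>x. ennreal (g x)" 1 "-c"] nn_integral_inverse_sqrt_abs[of \<delta>] assms
    by (simp add: g_def add.commute)
  have "AE x in lborel. ennreal (disc_potential p \<delta> x) \<le> ennreal (g (fst x - fst p) * g (snd x - snd p))"
    using AE_fst_neq_snd_neq[of "fst p" "snd p"]
  proof eventually_elim
    case (elim x)
    define u v where "u = fst x - fst p" and "v = snd x - snd p"
    have uv: "u \<noteq> 0" "v \<noteq> 0" using elim by (auto simp: u_def v_def)
    have d: "dist x p = sqrt (u\<^sup>2 + v\<^sup>2)"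
      by (simp add: dist_prod_def dist_real_def u_def v_def)
    have "disc_potential p \<delta> x \<le> g u * g v"
    proof (cases "dist x p < \<delta>")
      case True
      have "\<bar>u\<bar> \<le> dist x p" "\<bar>v\<bar> \<le> dist x p"
        unfolding d by (simp_all add: real_le_rsqrt)
      then have g: "g u * g v = 1 / sqrt (\<bar>u\<bar> * \<bar>v\<bar>)"
        using True by (auto simp: g_def indicator_def real_sqrt_mult abs_le_iff)
      have "\<bar>u\<bar> * \<bar>v\<bar> \<le> u\<^sup>2 + v\<^sup>2"
        using sum_squares_bound[of "\<bar>u\<bar>" "\<bar>v\<bar>"] mult_nonneg_nonneg[of "\<bar>u\<bar>" "\<bar>v\<bar>"]
        unfolding power2_abs mult.assoc by linarith
      then have "sqrt (\<bar>u\<bar> * \<bar>v\<bar>) \<le> dist x p" unfolding d by simp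
      then show ?thesis using True uv unfolding g by (simp add: disc_potential_def frac_le)
    qed (simp add: disc_potential_def g0)
    then show ?case unfolding u_def v_def by (rule ennreal_leI)
  qed
  then have "(\<integral>\<^sup>+ x. ennreal (disc_potential p \<delta> x) \<partial>lborel)
      \<le> (\<integral>\<^sup>+ x. ennreal (g (fst x - fst p) * g (snd x - snd p)) \<partial>lborel)"
    by (rule nn_integral_mono_AE)
  also have "\<dots> = (\<integral>\<^sup>+ x. ennreal (g (fst x - fst p) * g (snd x - snd p)) \<partial>(lborel \<Otimes>\<^sub>M lborel))"
    by (simp only: lborel_prod)
  also have "\<dots> = (\<integral>\<^sup>+ a. \<integral>\<^sup>+ b. ennreal (g (a - fst p)) * ennreal (g (b - snd p)) \<partial>lborel \<partial>lborel)"
    by (subst lborel.nn_integral_fst[symmetric]) (simp_all add: ennreal_mult g0)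
  also have "\<dots> = ennreal (4 * sqrt \<delta>) * ennreal (4 * sqrt \<delta>)"
    by (simp add: nn_integral_cmult nn_integral_multc shift)
  also have "\<dots> = ennreal (16 * \<delta>)"
    using assms by (simp flip: ennreal_mult)
  finally show ?thesis .
qed

lemma half_plane_sets: "{(r, z). r \<ge> 0} \<in> sets (borel :: (real \<times> real) measure)"
proof -
  have "closed {x :: real \<times> real. 0 \<le> fst x}" by (intro closed_Collect_le continuous_intros)
  from borel_closed[OF this] show ?thesis by (simp add: case_prod_unfold)
qed

lemma half_plane_Int_space: "{(r, z). r \<ge> 0} \<inter> space lebesgue \<in> sets (lebesgue :: (real \<times> real) measure)"
  using half_plane_sets by auto

lemma space_Omega: "space Omega = {(r, z). r \<ge> 0}"
  by (simp add: Omega_def space_restrict_space)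

lemma AE_Omega_iff: "(AE x in Omega. P x) \<longleftrightarrow> (AE x in lborel. fst x \<ge> 0 \<longrightarrow> P x)"
  unfolding Omega_def AE_restrict_space_iff[OF half_plane_Int_space] AE_completion_iff
  by (simp add: case_prod_unfold)

text \<open>The formula and the bound for the kernel hold away from the axis and from the line at the height of the
evaluation point.\<close>
lemma AE_Omega_nondegenerate: "AE x in Omega. fst x > 0 \<and> snd x \<noteq> zb"
  unfolding AE_Omega_iff using AE_fst_neq_snd_neq[of 0 zb] by eventually_elim auto

lemma borel_measurable_Omega:
  "f \<in> measurable borel N \<Longrightarrow> f \<in> measurable Omega N"
  unfolding Omega_def
  by (intro measurable_restrict_space1 measurable_completion) simp

lemma nn_integral_Omega_le: "(\<integral>\<^sup>+ x. f x \<partial>Omega) \<le> (\<integral>\<^sup>+ x. f x \<partial>lborel)"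
  unfolding Omega_def nn_integral_restrict_space[OF half_plane_Int_space] nn_integral_completion
  by (intro nn_integral_mono) (auto simp: indicator_def)

lemma borel_measurable_Omega_iff:
  fixes f :: "real \<times> real \<Rightarrow> real"
  shows "f \<in> borel_measurable Omega \<longleftrightarrow> (\<lambda>x. indicator {(r, z). r \<ge> 0} x *\<^sub>R f x) \<in> borel_measurable lebesgue"
  unfolding Omega_def by (rule borel_measurable_restrict_space_iff[OF half_plane_Int_space])

text \<open>Completeness of Lebesgue measure; it transfers measurability from the explicit kernel to \<open>Z\<close>, whose
values on the exceptional null set are those of an arbitrary \<open>deriv\<close>.\<close>
lemma borel_measurable_Omega_cong_AE:
  fixes f g :: "real \<times> real \<Rightarrow> real"
  assumes "f \<in> borel_measurable Omega" "AE x in Omega. f x = g x"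
  shows "g \<in> borel_measurable Omega"
  using assms(1) unfolding borel_measurable_Omega_iff
proof (rule borel_measurable_AE)
  show "AE x in lebesgue. indicator {(r, z). r \<ge> 0} x *\<^sub>R f x = indicator {(r, z). r \<ge> 0} x *\<^sub>R g x"
    using assms(2) unfolding AE_Omega_iff AE_completion_iff
    by eventually_elim (auto simp: indicator_def)
qed

lemma borel_measurable_axial_kernel [measurable (raw)]:
  assumes [measurable]: "f \<in> borel_measurable M" "g \<in> borel_measurable M" "h \<in> borel_measurable M"
  shows "(\<lambda>x. axial_kernel (f x) (g x) (h x)) \<in> borel_measurable M"
proof -
  have "(\<lambda>(x, t). indicator {0..pi} t *\<^sub>R ((h x - f x * cos t) / sqrt (dist_sq (f x) (g x) (h x) t) ^ 3))
      \<in> borel_measurable (M \<Otimes>\<^sub>M lborel)"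
    unfolding dist_sq_def by measurable
  then have "(\<lambda>x. \<integral>t. indicator {0..pi} t *\<^sub>R ((h x - f x * cos t) / sqrt (dist_sq (f x) (g x) (h x) t) ^ 3) \<partial>lborel)
      \<in> borel_measurable M"
    by (rule lborel.borel_measurable_lebesgue_integral)
  then show ?thesis
    unfolding axial_kernel_def set_lebesgue_integral_def by measurable
qed

section \<open>The velocity estimate\<close>

text \<open>The splitting into a near and a far part. The parameter is \<open>q = \<delta> * (\<delta> + rb)\<close> instead of the splitting radius \<open>\<delta>\<close>,
so that the bound does not depend on the evaluation point.\<close>
lemma nn_integral_axial_kernel_le:
  assumes \<omega> [measurable]: "\<omega> \<in> borel_measurable Omega"
    and rb: "rb > 0" and M: "M \<ge> 0" and q: "q > 0"
    and \<omega>_le: "AE x in Omega. \<bar>\<omega> x\<bar> \<le> M * fst x"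
  shows "(\<integral>\<^sup>+ x. ennreal \<bar>axial_kernel rb (snd x - zb) (fst x) * \<omega> x\<bar> \<partial>Omega)
      \<le> ennreal (16 * M * q) + ennreal (1 / q) * (\<integral>\<^sup>+ x. ennreal (fst x * \<bar>\<omega> x\<bar>) \<partial>Omega)"
proof -
  have [measurable]: "fst \<in> borel_measurable Omega" "snd \<in> borel_measurable Omega"
    "\<And>p \<delta>. disc_potential p \<delta> \<in> borel_measurable Omega"
    by (intro borel_measurable_Omega; simp add: borel_measurable_continuous_onI continuous_on_fst continuous_on_snd)+
  \<comment> \<open>\<open>\<delta>\<close> is the positive root of \<open>\<delta> * (\<delta> + rb) = q\<close>.\<close>
  define s where "s = sqrt (rb\<^sup>2 + 4 * q)"
  define \<delta> where "\<delta> = (s - rb) / 2"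
  have s2: "s\<^sup>2 = rb\<^sup>2 + 4 * q" using q by (simp add: s_def)
  have "s > rb" unfolding s_def by (rule real_less_rsqrt) (use q in simp)
  then have \<delta>: "\<delta> > 0" by (simp add: \<delta>_def)
  have \<delta>q: "\<delta> * (\<delta> + rb) = q"
    using s2 by (simp add: \<delta>_def field_simps power2_eq_square)
  define W where "W = disc_potential (rb, zb) \<delta>"
  have W0: "W x \<ge> 0" for x by (simp add: W_def disc_potential_def)
  have [measurable]: "W \<in> borel_measurable Omega" by (simp add: W_def)
  have "AE x in Omega. ennreal \<bar>axial_kernel rb (snd x - zb) (fst x) * \<omega> x\<bar>
      \<le> ennreal (M * (\<delta> + rb)) * ennreal (W x) + ennreal (1 / q) * ennreal (fst x * \<bar>\<omega> x\<bar>)"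
    using \<omega>_le AE_Omega_nondegenerate[of zb]
  proof eventually_elim
    case (elim x)
    define r D where "r = fst x" and "D = sqrt ((r - rb)\<^sup>2 + (snd x - zb)\<^sup>2)"
    have r: "r > 0" and \<zeta>: "snd x - zb \<noteq> 0" and w: "\<bar>\<omega> x\<bar> \<le> M * r" using elim by (auto simp: r_def)
    have D: "D > 0" using \<zeta> by (simp add: D_def add_nonneg_pos)
    have dist: "dist x (rb, zb) = D"
      by (simp add: dist_prod_def dist_real_def D_def r_def)
    have "\<bar>r - rb\<bar> \<le> D" unfolding D_def by (rule real_le_rsqrt) simp
    then have rD: "r \<le> D + rb" by linarith
    have K: "\<bar>axial_kernel rb (snd x - zb) r * \<omega> x\<bar> \<le> r / (D * (D + rb)) * \<bar>\<omega> x\<bar>"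
      unfolding abs_mult using axial_kernel_bound[OF rb r \<zeta>] by (intro mult_right_mono) (auto simp: D_def)
    have "r / (D * (D + rb)) * \<bar>\<omega> x\<bar> \<le> M * (\<delta> + rb) * W x + 1 / q * (r * \<bar>\<omega> x\<bar>)"
    proof (cases "D < \<delta>")
      case True
      have "r / (D * (D + rb)) * \<bar>\<omega> x\<bar> \<le> (D + rb) / (D * (D + rb)) * (M * (D + rb))"
        using w rD r D rb M
        by (intro mult_mono divide_right_mono order_trans[OF w] mult_left_mono) auto
      also have "\<dots> = M * (D + rb) * (1 / D)" using D rb by simp
      also have "\<dots> \<le> M * (\<delta> + rb) * W x"
        using True D M rb unfolding W_def disc_potential_def dist by (simp add: divide_right_mono mult_left_mono)
      also have "\<dots> \<le> M * (\<delta> + rb) * W x + 1 / q * (r * \<bar>\<omega> x\<bar>)"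
        using q r by simp
      finally show ?thesis .
    next
      case False
      then have "q \<le> D * (D + rb)"
        unfolding \<delta>q[symmetric] using \<delta> rb by (intro mult_mono) auto
      then have "r * \<bar>\<omega> x\<bar> / (D * (D + rb)) \<le> r * \<bar>\<omega> x\<bar> / q"
        using q r by (intro divide_left_mono mult_pos_pos) (use D rb in auto)
      moreover have "M * (\<delta> + rb) * W x \<ge> 0" using M \<delta> rb W0 by simp
      ultimately show ?thesis by simp
    qed
    with K have "\<bar>axial_kernel rb (snd x - zb) r * \<omega> x\<bar> \<le> M * (\<delta> + rb) * W x + 1 / q * (r * \<bar>\<omega> x\<bar>)"
      by (rule order_trans)
    then have "ennreal \<bar>axial_kernel rb (snd x - zb) r * \<omega> x\<bar>
        \<le> ennreal (M * (\<delta> + rb) * W x + 1 / q * (r * \<bar>\<omega> x\<bar>))"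
      by (rule ennreal_leI)
    also have "\<dots> = ennreal (M * (\<delta> + rb)) * ennreal (W x) + ennreal (1 / q) * ennreal (r * \<bar>\<omega> x\<bar>)"
      using M \<delta> rb q r W0 by (simp only: ennreal_plus ennreal_mult[symmetric] mult_nonneg_nonneg
        abs_ge_zero less_imp_le add_nonneg_nonneg divide_nonneg_nonneg zero_le_one)
    finally show ?case by (simp add: r_def)
  qed
  then have "(\<integral>\<^sup>+ x. ennreal \<bar>axial_kernel rb (snd x - zb) (fst x) * \<omega> x\<bar> \<partial>Omega)
      \<le> (\<integral>\<^sup>+ x. ennreal (M * (\<delta> + rb)) * ennreal (W x) + ennreal (1 / q) * ennreal (fst x * \<bar>\<omega> x\<bar>) \<partial>Omega)"
    by (rule nn_integral_mono_AE)
  also have "\<dots> = ennreal (M * (\<delta> + rb)) * (\<integral>\<^sup>+ x. ennreal (W x) \<partial>Omega)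
      + ennreal (1 / q) * (\<integral>\<^sup>+ x. ennreal (fst x * \<bar>\<omega> x\<bar>) \<partial>Omega)"
    by (simp add: nn_integral_add nn_integral_cmult)
  also have "(\<integral>\<^sup>+ x. ennreal (W x) \<partial>Omega) \<le> ennreal (16 * \<delta>)"
    using nn_integral_Omega_le nn_integral_disc_potential_le[OF \<delta>] unfolding W_def by (rule order_trans)
  also have "ennreal (M * (\<delta> + rb)) * ennreal (16 * \<delta>) = ennreal (16 * M * q)"
    unfolding \<delta>q[symmetric] using M \<delta> rb by (simp add: ennreal_mult[symmetric] ac_simps)
  finally show ?thesis by (simp add: add_mono mult_left_mono)
qed

text \<open>The Cauchy-Schwarz inequality for the measure with density \<open>\<bar>\<omega>\<bar>\<close>, obtained by optimising \<open>t\<close> in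
\<open>r \<le> (t * r\<^sup>2 + 1 / t) / 2\<close>.\<close>
lemma nn_integral_moment_interpolation:
  assumes \<omega> [measurable]: "\<omega> \<in> borel_measurable Omega"
    and A: "L1_norm Omega (\<lambda>(r, z). r\<^sup>2 * \<omega> (r, z)) < \<infinity>" and B: "L1_norm Omega \<omega> < \<infinity>"
  shows "(\<integral>\<^sup>+ x. ennreal (fst x * \<bar>\<omega> x\<bar>) \<partial>Omega)
    \<le> ennreal (sqrt (enn2real (L1_norm Omega (\<lambda>(r, z). r\<^sup>2 * \<omega> (r, z))) * enn2real (L1_norm Omega \<omega>)))"
proof -
  have [measurable]: "fst \<in> borel_measurable Omega"
    by (intro borel_measurable_Omega) (simp add: borel_measurable_continuous_onI continuous_on_fst)
  define P where "P = (\<integral>\<^sup>+ x. ennreal (fst x * \<bar>\<omega> x\<bar>) \<partial>Omega)"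
  define a b where "a = enn2real (L1_norm Omega (\<lambda>(r, z). r\<^sup>2 * \<omega> (r, z)))"
    and "b = enn2real (L1_norm Omega \<omega>)"
  have L1a: "(\<integral>\<^sup>+ x. ennreal ((fst x)\<^sup>2 * \<bar>\<omega> x\<bar>) \<partial>Omega) = ennreal a"
    using A unfolding a_def by (simp add: L1_norm_def case_prod_unfold abs_mult)
  have L1b: "(\<integral>\<^sup>+ x. ennreal \<bar>\<omega> x\<bar> \<partial>Omega) = ennreal b"
    using B unfolding b_def by (simp add: L1_norm_def)
  have P_le: "P \<le> ennreal (a / 2 * t + b / 2 / t)" if t: "t > 0" for t
  proof -
    have "P \<le> (\<integral>\<^sup>+ x. ennreal (t / 2) * ennreal ((fst x)\<^sup>2 * \<bar>\<omega> x\<bar>) + ennreal (1 / (2 * t)) * ennreal \<bar>\<omega> x\<bar> \<partial>Omega)"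
      unfolding P_def
    proof (intro nn_integral_mono)
      fix x :: "real \<times> real"
      have "2 * fst x * t \<le> (fst x * t)\<^sup>2 + 1"
        using sum_squares_bound[of "fst x * t" 1] by simp
      then have "fst x \<le> t / 2 * (fst x)\<^sup>2 + 1 / (2 * t)"
        using t by (simp add: field_simps power2_eq_square)
      then have "fst x * \<bar>\<omega> x\<bar> \<le> (t / 2 * (fst x)\<^sup>2 + 1 / (2 * t)) * \<bar>\<omega> x\<bar>"
        by (intro mult_right_mono) auto
      also have "\<dots> = t / 2 * ((fst x)\<^sup>2 * \<bar>\<omega> x\<bar>) + 1 / (2 * t) * \<bar>\<omega> x\<bar>"
        by (simp only: distrib_right mult.assoc)
      finally have "ennreal (fst x * \<bar>\<omega> x\<bar>) \<le> ennreal (t / 2 * ((fst x)\<^sup>2 * \<bar>\<omega> x\<bar>) + 1 / (2 * t) * \<bar>\<omega> x\<bar>)"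
        by (rule ennreal_leI)
      also have "\<dots> = ennreal (t / 2) * ennreal ((fst x)\<^sup>2 * \<bar>\<omega> x\<bar>) + ennreal (1 / (2 * t)) * ennreal \<bar>\<omega> x\<bar>"
        using t by (simp only: ennreal_plus ennreal_mult[symmetric] mult_nonneg_nonneg abs_ge_zero
          zero_le_power2 less_imp_le divide_nonneg_nonneg zero_le_one zero_le_numeral)
      finally show "ennreal (fst x * \<bar>\<omega> x\<bar>) \<le> \<dots>" .
    qed
    also have "\<dots> = ennreal (t / 2) * ennreal a + ennreal (1 / (2 * t)) * ennreal b"
      by (simp add: nn_integral_add nn_integral_cmult L1a L1b)
    also have "\<dots> = ennreal (a / 2 * t + b / 2 / t)"
      using t by (simp add: a_def b_def ac_simps flip: ennreal_plus ennreal_mult)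
    finally show ?thesis .
  qed
  have Pfin: "P < \<infinity>" using P_le[of 1] by (simp add: le_less_trans)
  have "enn2real P \<le> a / 2 * t + b / 2 / t" if "t > 0" for t
    using P_le[OF that] that by (intro enn2real_leI) (simp_all add: a_def b_def)
  then have "enn2real P \<le> 2 * sqrt (a / 2 * (b / 2))"
    by (rule le_geometric_mean) (simp_all add: a_def b_def)
  also have "\<dots> = sqrt (a * b)" by (simp add: real_sqrt_divide)
  finally have "P \<le> ennreal (sqrt (a * b))"
    using Pfin by (metis ennreal_enn2real ennreal_leI infinity_ennreal_def)
  then show ?thesis by (simp only: P_def a_def b_def)
qed

lemma nn_integral_axial_kernel_bound:
  fixes \<omega> :: "real \<times> real \<Rightarrow> real"
  assumes \<omega>: "\<omega> \<in> borel_measurable Omega" and rb: "rb > 0"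
    and A: "L1_norm Omega (\<lambda>(r, z). r\<^sup>2 * \<omega> (r, z)) < \<infinity>" and B: "L1_norm Omega \<omega> < \<infinity>"
    and L: "Linf_norm Omega (\<lambda>(r, z). \<omega> (r, z) / r) < \<infinity>"
  shows "(\<integral>\<^sup>+ x. ennreal \<bar>axial_kernel rb (snd x - zb) (fst x) * \<omega> x\<bar> \<partial>Omega)
      \<le> ennreal (8 * enn2real (L1_norm Omega (\<lambda>(r, z). r\<^sup>2 * \<omega> (r, z))) powr (1/4)
                     * enn2real (L1_norm Omega \<omega>) powr (1/4)
                     * enn2real (Linf_norm Omega (\<lambda>(r, z). \<omega> (r, z) / r)) powr (1/2))"
proof -
  define I where "I = (\<integral>\<^sup>+ x. ennreal \<bar>axial_kernel rb (snd x - zb) (fst x) * \<omega> x\<bar> \<partial>Omega)"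
  define a b M where "a = enn2real (L1_norm Omega (\<lambda>(r, z). r\<^sup>2 * \<omega> (r, z)))"
    and "b = enn2real (L1_norm Omega \<omega>)"
    and "M = enn2real (Linf_norm Omega (\<lambda>(r, z). \<omega> (r, z) / r))"
  have nonneg: "a \<ge> 0" "b \<ge> 0" "M \<ge> 0" by (simp_all add: a_def b_def M_def)
  have "AE x in Omega. ennreal \<bar>case x of (r, z) \<Rightarrow> \<omega> (r, z) / r\<bar> \<le> ennreal M"
    using esssup_AE[of "\<lambda>x. ennreal \<bar>case x of (r, z) \<Rightarrow> \<omega> (r, z) / r\<bar>" Omega] L
    by (simp add: M_def Linf_norm_def)
  then have \<omega>_le: "AE x in Omega. \<bar>\<omega> x\<bar> \<le> M * fst x"
    using AE_Omega_nondegenerate[of 0]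
  proof eventually_elim
    case (elim x)
    then have "\<bar>\<omega> x\<bar> / fst x \<le> M"
      using nonneg(3) by (simp add: case_prod_unfold abs_divide)
    then show ?case using elim by (simp add: field_simps)
  qed
  have I_le: "I \<le> ennreal (16 * M * q + sqrt (a * b) / q)" if q: "q > 0" for q
  proof -
    have "I \<le> ennreal (16 * M * q) + ennreal (1 / q) * (\<integral>\<^sup>+ x. ennreal (fst x * \<bar>\<omega> x\<bar>) \<partial>Omega)"
      unfolding I_def by (rule nn_integral_axial_kernel_le[OF \<omega> rb nonneg(3) q \<omega>_le])
    also have "\<dots> \<le> ennreal (16 * M * q) + ennreal (1 / q) * ennreal (sqrt (a * b))"
      unfolding a_def b_def by (intro add_left_mono mult_left_mono nn_integral_moment_interpolation \<omega> A B) simp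
    also have "\<dots> = ennreal (16 * M * q + sqrt (a * b) / q)"
      using q nonneg by (simp flip: ennreal_plus ennreal_mult)
    finally show ?thesis .
  qed
  have fin: "I < \<infinity>" using I_le[of 1] by (simp add: le_less_trans)
  have "enn2real I \<le> 16 * M * q + sqrt (a * b) / q" if "q > 0" for q
    using nonneg that by (intro enn2real_leI I_le) simp_all
  then have "enn2real I \<le> 2 * sqrt (16 * M * sqrt (a * b))"
    by (rule le_geometric_mean) (use nonneg in auto)
  also have "\<dots> = 8 * sqrt (sqrt a) * sqrt (sqrt b) * sqrt M"
    by (simp add: real_sqrt_mult)
  also have "\<dots> = 8 * a powr (1/4) * b powr (1/4) * M powr (1/2)"
  proof -
    have "sqrt (sqrt x) = x powr (1/4)" if "x \<ge> 0" for x :: real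
      using that by (simp add: powr_powr flip: powr_half_sqrt)
    then show ?thesis using nonneg by (simp add: powr_half_sqrt)
  qed
  finally have "I \<le> ennreal (8 * a powr (1/4) * b powr (1/4) * M powr (1/2))"
    using fin by (metis ennreal_enn2real ennreal_leI infinity_ennreal_def)
  then show ?thesis by (simp only: I_def a_def b_def M_def)
qed

lemma AE_Z_eq_axial_kernel:
  "rb > 0 \<Longrightarrow> AE x in Omega. Z rb zb (fst x) (snd x) = axial_kernel rb (snd x - zb) (fst x)"
  using AE_Omega_nondegenerate[of zb] by eventually_elim (simp add: Z_eq_axial_kernel)

text \<open>Measurability of parameter integrals requires a jointly measurable integrand, which \<open>\<omega>\<close>, being only Lebesgue
measurable, need not provide; a Borel representative does. On the axis \<open>Z\<close> vanishes because \<open>1 / 0 = 0\<close>.\<close>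
lemma borel_measurable_u_z:
  assumes \<omega>: "\<omega> \<in> borel_measurable Omega"
  shows "u_z \<omega> \<in> borel_measurable Omega"
proof -
  have [measurable]: "(fst :: real \<times> real \<Rightarrow> real) \<in> borel_measurable borel"
    "(snd :: real \<times> real \<Rightarrow> real) \<in> borel_measurable borel"
    by (simp_all add: borel_measurable_continuous_onI continuous_on_fst continuous_on_snd)
  define S :: "(real \<times> real) set" where "S = {(r, z). r \<ge> 0}"
  have "(\<lambda>x. indicator S x *\<^sub>R \<omega> x) \<in> borel_measurable lebesgue"
    using \<omega> unfolding borel_measurable_Omega_iff S_def .
  from completion_ex_borel_measurable_real[OF this]
  obtain \<omega>' where \<omega>' [measurable]: "\<omega>' \<in> borel_measurable borel"
    and eq: "AE x in lborel. indicator S x *\<^sub>R \<omega> x = \<omega>' x" by auto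
  define U where "U p = (\<integral>x. axial_kernel (fst p) (snd x - snd p) (fst x) * \<omega>' x \<partial>lborel)" for p :: "real \<times> real"
  have [measurable]: "U \<in> borel_measurable borel"
  proof -
    have [measurable]: "(fst :: real \<times> real \<Rightarrow> real) \<in> borel_measurable lborel"
      "(snd :: real \<times> real \<Rightarrow> real) \<in> borel_measurable lborel" "\<omega>' \<in> borel_measurable lborel"
      using \<omega>' by (simp_all add: borel_measurable_continuous_onI continuous_on_fst continuous_on_snd)
    have "(\<lambda>(p, x). axial_kernel (fst p) (snd x - snd p) (fst x) * \<omega>' x) \<in> borel_measurable (lborel \<Otimes>\<^sub>M lborel)"
      unfolding case_prod_unfold by measurable
    from lborel.borel_measurable_lebesgue_integral[OF this] show ?thesis
      by (simp add: U_def[abs_def])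
  qed
  have "(\<lambda>p. if fst p > 0 then U p else 0) \<in> borel_measurable Omega"
    by (intro borel_measurable_Omega) measurable
  moreover have "u_z \<omega> p = (if fst p > 0 then U p else 0)" if "p \<in> space Omega" for p
  proof (cases "fst p > 0")
    case True
    have "u_z \<omega> p = (\<integral>x. indicator S x *\<^sub>R (Z (fst p) (snd p) (fst x) (snd x) * \<omega> x) \<partial>lebesgue)"
      unfolding u_z_def Omega_def S_def integral_restrict_space[OF half_plane_Int_space]
      by (simp add: case_prod_unfold)
    also have "\<dots> = (\<integral>x. axial_kernel (fst p) (snd x - snd p) (fst x) * \<omega>' x \<partial>lebesgue)"
    proof -
      have ae: "AE x in lebesgue. axial_kernel (fst p) (snd x - snd p) (fst x) * \<omega>' x
          = indicator S x *\<^sub>R (Z (fst p) (snd p) (fst x) (snd x) * \<omega> x)"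
        using eq AE_Z_eq_axial_kernel[OF True, of "snd p"] unfolding AE_Omega_iff AE_completion_iff
        by eventually_elim (auto simp: S_def indicator_def split: if_splits)
      have m: "(\<lambda>x. axial_kernel (fst p) (snd x - snd p) (fst x) * \<omega>' x) \<in> borel_measurable lebesgue"
        by (intro measurable_completion) (simp, measurable)
      show ?thesis
        by (rule integral_cong_AE[symmetric, OF m borel_measurable_AE[OF m ae] ae])
    qed
    also have "\<dots> = U p"
      unfolding U_def by (rule integral_completion) (simp, measurable)
    finally show ?thesis using True by simp
  next
    case False
    then have "fst p = 0" using that by (auto simp: space_Omega)
    then show ?thesis by (simp add: u_z_def Z_def case_prod_unfold)
  qed
  ultimately show ?thesis
    by (subst measurable_cong[where g = "\<lambda>p. if fst p > 0 then U p else 0"]) auto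
qed

theorem proposition2p13:
  "\<exists>C\<^sub>2 > (0::real). \<forall>\<omega> :: real \<times> real \<Rightarrow> real.
     \<omega> \<in> borel_measurable Omega \<longrightarrow>
     L1_norm Omega (\<lambda>(r, z). r\<^sup>2 * \<omega> (r, z)) < \<infinity> \<longrightarrow>
     L1_norm Omega \<omega> < \<infinity> \<longrightarrow>
     Linf_norm Omega (\<lambda>(r, z). \<omega> (r, z) / r) < \<infinity> \<longrightarrow>
       (\<forall>rb > 0. \<forall>zb. integrable Omega (\<lambda>(r, z). Z rb zb r z * \<omega> (r, z))) \<and>
       Linf_norm Omega (u_z \<omega>) \<le>
         ennreal (C\<^sub>2 * enn2real (L1_norm Omega (\<lambda>(r, z). r\<^sup>2 * \<omega> (r, z))) powr (1/4)
                     * enn2real (L1_norm Omega \<omega>) powr (1/4)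
                     * enn2real (Linf_norm Omega (\<lambda>(r, z). \<omega> (r, z) / r)) powr (1/2))"
proof (intro exI[of _ "8 :: real"] conjI allI impI)
  fix \<omega> :: "real \<times> real \<Rightarrow> real"
  assume \<omega>: "\<omega> \<in> borel_measurable Omega"
    and A: "L1_norm Omega (\<lambda>(r, z). r\<^sup>2 * \<omega> (r, z)) < \<infinity>" and B: "L1_norm Omega \<omega> < \<infinity>"
    and L: "Linf_norm Omega (\<lambda>(r, z). \<omega> (r, z) / r) < \<infinity>"
  define C where "C = 8 * enn2real (L1_norm Omega (\<lambda>(r, z). r\<^sup>2 * \<omega> (r, z))) powr (1/4)
                     * enn2real (L1_norm Omega \<omega>) powr (1/4)
                     * enn2real (Linf_norm Omega (\<lambda>(r, z). \<omega> (r, z) / r)) powr (1/2)"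
  have bound: "(\<integral>\<^sup>+ x. ennreal \<bar>case x of (r, z) \<Rightarrow> Z rb zb r z * \<omega> (r, z)\<bar> \<partial>Omega) \<le> ennreal C" if "rb > 0" for rb zb
  proof -
    have "(\<integral>\<^sup>+ x. ennreal \<bar>case x of (r, z) \<Rightarrow> Z rb zb r z * \<omega> (r, z)\<bar> \<partial>Omega)
        = (\<integral>\<^sup>+ x. ennreal \<bar>axial_kernel rb (snd x - zb) (fst x) * \<omega> x\<bar> \<partial>Omega)"
      using AE_Z_eq_axial_kernel[OF that, of zb]
      by (intro nn_integral_cong_AE) (auto simp: case_prod_unfold)
    also have "\<dots> \<le> ennreal C"
      unfolding C_def by (rule nn_integral_axial_kernel_bound[OF \<omega> that A B L])
    finally show ?thesis .
  qed
  have integrable: "integrable Omega (\<lambda>(r, z). Z rb zb r z * \<omega> (r, z))" if "rb > 0" for rb zb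
  proof (rule integrableI_bounded)
    have [measurable]: "fst \<in> borel_measurable Omega" "snd \<in> borel_measurable Omega"
      by (intro borel_measurable_Omega; simp add: borel_measurable_continuous_onI continuous_on_fst continuous_on_snd)+
    have "(\<lambda>x. axial_kernel rb (snd x - zb) (fst x) * \<omega> x) \<in> borel_measurable Omega"
      using \<omega> by measurable
    then show "(\<lambda>(r, z). Z rb zb r z * \<omega> (r, z)) \<in> borel_measurable Omega"
      by (rule borel_measurable_Omega_cong_AE)
         (use AE_Z_eq_axial_kernel[OF that, of zb] in \<open>auto simp: case_prod_unfold\<close>)
    show "(\<integral>\<^sup>+ x. ennreal (norm (case x of (r, z) \<Rightarrow> Z rb zb r z * \<omega> (r, z))) \<partial>Omega) < \<infinity>"
      using bound[OF that, of zb] by (simp add: le_less_trans)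
  qed
  show "integrable Omega (\<lambda>(r, z). Z rb zb r z * \<omega> (r, z))" if "rb > 0" for rb zb
    using that by (rule integrable)
  have "AE p in Omega. ennreal \<bar>u_z \<omega> p\<bar> \<le> ennreal C"
    using AE_Omega_nondegenerate[of 0]
  proof eventually_elim
    case (elim p)
    then have "ennreal \<bar>u_z \<omega> p\<bar> \<le> (\<integral>\<^sup>+ x. ennreal \<bar>case x of (r, z) \<Rightarrow> Z (fst p) (snd p) r z * \<omega> (r, z)\<bar> \<partial>Omega)"
      using integral_norm_bound_ennreal[OF integrable[of "fst p" "snd p"]]
      by (simp add: u_z_def case_prod_unfold)
    also have "\<dots> \<le> ennreal C" using elim by (intro bound) simp
    finally show ?case .
  qed
  then have "Linf_norm Omega (u_z \<omega>) \<le> ennreal C"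
    unfolding Linf_norm_def using borel_measurable_u_z[OF \<omega>] by (intro esssup_I) auto
  then show "Linf_norm Omega (u_z \<omega>) \<le> ennreal (8 * enn2real (L1_norm Omega (\<lambda>(r, z). r\<^sup>2 * \<omega> (r, z))) powr (1/4)
                     * enn2real (L1_norm Omega \<omega>) powr (1/4)
                     * enn2real (Linf_norm Omega (\<lambda>(r, z). \<omega> (r, z) / r)) powr (1/2))"
    unfolding C_def .
qed simp

end
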